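(* For all $a,b>0$ with $a\ne b$, $$\frac{\frac{e(\pi-2)}{\pi}X+P}{2}<\frac{A+G}{2}<\frac{P+X}{2}<\left(e^{-1}+\frac2\pi\right)\frac{A+G}{2}.$$
   Context: For $a,b>0$ with $a\neq b$: $A=\frac{a+b}{2}$, $G=\sqrt{ab}$, $P=\frac{a-b}{2\arcsin\frac{a-b}{a+b}}$ (first Seiffert mean), and $X=A e^{G/P-1}$. *)

theory Defs
  imports "HOL-Analysis.Analysis"
begin

definition arith_mean :: "real \<Rightarrow> real \<Rightarrow> real" where
  "arith_mean a b = (a + b) / 2"

definition geo_mean :: "real \<Rightarrow> real \<Rightarrow> real" where
  "geo_mean a b = sqrt (a * b)"

(* Only meaningful for a \<noteq> b; on the diagonal division by zero gives 0. *)
definition seiffert_mean :: "real \<Rightarrow> real \<Rightarrow> real" where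
  "seiffert_mean a b = (a - b) / (2 * arcsin ((a - b) / (a + b)))"

definition X_mean :: "real \<Rightarrow> real \<Rightarrow> real" where
  "X_mean a b = arith_mean a b * exp (geo_mean a b / seiffert_mean a b - 1)"

end

theory Submission
  imports Defs "HOL-Real_Asymp.Real_Asymp"
begin

text \<open>
  By homogeneity and symmetry take \<open>A = 1\<close> and \<open>(a - b) / (a + b) = sin t\<close> with
  \<open>0 < t < \<pi>/2\<close>; then \<open>G = cos t\<close>, \<open>P = sin t / t\<close> and \<open>X = exp (t cot t - 1)\<close>.
  The function \<open>(A + G - P) / X\<close> is strictly decreasing in \<open>t\<close>: its derivative factors and its sign
  is given by Wilker's inequality \<open>(sin y / y)\<^sup>2 + tan y / y > 2\<close> at \<open>y = t/2\<close>. Its limits at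
  \<open>\<pi>/2\<close> and \<open>0\<close> give the first and the second bound. The function \<open>(P + X) / (A + G)\<close> has derivative
  \<open>(t - sin t) / (1 + cos t) * (1 / t\<^sup>2 - X / (sin t)\<^sup>2)\<close>, which is positive because \<open>X < P\<^sup>2\<close>;
  the latter follows from the second Wilker inequality \<open>(t / sin t)\<^sup>2 + t cot t > 2\<close>.
  The value of \<open>(P + X) / (A + G)\<close> at \<open>\<pi>/2\<close> is the third bound.
\<close>

section \<open>Monotonicity from a one-sided limit, and elementary bounds for sine and
  tangent\<close>

text \<open>A limit at 0 replaces a value because the functions of interest involve
  \<open>sin t / t\<close> and \<open>t * cos t / sin t\<close>. The limit alone gives only
  \<open>L \<le> f (x/2)\<close>; the step from \<open>x/2\<close> to \<open>x\<close> restores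
  strictness.\<close>

lemma DERIV_pos_imp_greater_right_limit:
  fixes f f' :: "real \<Rightarrow> real"
  assumes deriv: "\<And>x. 0 < x \<Longrightarrow> x \<le> b \<Longrightarrow> (f has_real_derivative f' x) (at x)"
    and pos: "\<And>x. 0 < x \<Longrightarrow> x < b \<Longrightarrow> f' x > 0"
    and lim: "(f \<longlongrightarrow> L) (at_right 0)"
    and x: "0 < x" "x \<le> b"
  shows "L < f x"
proof -
  have mono: "f u < f v" if "0 < u" "u < v" "v \<le> b" for u v
  proof (rule DERIV_pos_imp_increasing_open[OF \<open>u < v\<close>])
    show "\<exists>y. (f has_real_derivative y) (at z) \<and> 0 < y" if "u < z" "z < v" for z
      using deriv[of z] pos[of z] that \<open>0 < u\<close> \<open>v \<le> b\<close> by force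
    show "continuous_on {u..v} f"
      by (rule DERIV_continuous_on, rule has_field_derivative_at_within[OF deriv])
        (use that in auto)
  qed
  have "eventually (\<lambda>u. f u \<le> f (x/2)) (at_right 0)"
    using eventually_at_right_less[of 0] eventually_at_right_real[of 0 "x/2"] x
    by (auto elim!: eventually_mono intro!: less_imp_le mono)
  then have "L \<le> f (x/2)"
    using lim by (intro tendsto_upperbound[OF lim]) auto
  also have "\<dots> < f x" using mono x by auto
  finally show ?thesis .
qed

lemma mult_cos_less_sin:
  fixes x :: real
  assumes "0 < x" "x \<le> pi/2"
  shows "x * cos x < sin x"
proof -
  have "0 < sin x - x * cos x"
  proof (rule DERIV_pos_imp_greater_right_limit[where f = "\<lambda>x. sin x - x * cos x"
        and f' = "\<lambda>x. x * sin x" and b = "pi/2"])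
    show "((\<lambda>x. sin x - x * cos x) has_real_derivative x * sin x) (at x)" for x :: real
      by (auto intro!: derivative_eq_intros)
    show "((\<lambda>x::real. sin x - x * cos x) \<longlongrightarrow> 0) (at_right 0)" by real_asymp
  qed (use assms in \<open>auto intro!: mult_pos_pos sin_gt_zero\<close>)
  then show ?thesis by simp
qed

lemma sin_less_arg:
  fixes x :: real
  assumes "0 < x" "x \<le> pi/2"
  shows "sin x < x"
proof -
  have "0 < x - sin x"
  proof (rule DERIV_pos_imp_greater_right_limit[where f = "\<lambda>x. x - sin x"
        and f' = "\<lambda>x. 1 - cos x" and b = "pi/2"])
    show "((\<lambda>x. x - sin x) has_real_derivative 1 - cos x) (at x)" for x :: real
      by (auto intro!: derivative_eq_intros)
    show "((\<lambda>x::real. x - sin x) \<longlongrightarrow> 0) (at_right 0)" by real_asymp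
    show "0 < 1 - cos x" if "0 < x" "x < pi/2" for x
      using cos_monotone_0_pi[of 0 x] that by simp
  qed (use assms in auto)
  then show ?thesis by simp
qed

text \<open>The bound \<open>sin x < x\<close> is integrated twice, through the quadratic lower
  bound for cosine.\<close>

lemma sin_greater_cubic:
  fixes x :: real
  assumes "0 < x" "x \<le> pi/2"
  shows "x - x^3/6 < sin x"
proof -
  have cos: "0 < cos x - 1 + x^2/2" if "0 < x" "x \<le> pi/2" for x
  proof (rule DERIV_pos_imp_greater_right_limit[where f = "\<lambda>x. cos x - 1 + x^2/2"
        and f' = "\<lambda>x. x - sin x" and b = "pi/2"])
    show "((\<lambda>x. cos x - 1 + x^2/2) has_real_derivative x - sin x) (at x)" for x :: real
      by (auto intro!: derivative_eq_intros)
    show "((\<lambda>x::real. cos x - 1 + x^2/2) \<longlongrightarrow> 0) (at_right 0)" by real_asymp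
  qed (use that sin_less_arg in auto)
  have "0 < sin x - x + x^3/6"
  proof (rule DERIV_pos_imp_greater_right_limit[where f = "\<lambda>x. sin x - x + x^3/6"
        and f' = "\<lambda>x. cos x - 1 + x^2/2" and b = "pi/2"])
    show "((\<lambda>x. sin x - x + x^3/6) has_real_derivative cos x - 1 + x^2/2) (at x)" for x :: real
      by (auto intro!: derivative_eq_intros)
    show "((\<lambda>x::real. sin x - x + x^3/6) \<longlongrightarrow> 0) (at_right 0)" by real_asymp
  qed (use assms cos in auto)
  then show ?thesis by simp
qed

lemma tan_greater_cubic:
  fixes x :: real
  assumes "0 < x" "x < pi/2"
  shows "x + x^3/3 < tan x"
proof -
  have cos: "cos z > 0" if "0 < z" "z \<le> x" for z
    using that assms by (intro cos_gt_zero_pi) auto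
  have "0 < tan x - x - x^3/3"
  \<comment> \<open>The right end is \<open>x\<close> itself, since differentiability is needed
    there and fails for \<open>tan\<close> at \<open>pi/2\<close>.\<close>
  proof (rule DERIV_pos_imp_greater_right_limit[where f = "\<lambda>x. tan x - x - x^3/3"
        and f' = "\<lambda>x. (tan x)^2 - x^2" and b = x])
    show "((\<lambda>x. tan x - x - x^3/3) has_real_derivative (tan z)^2 - z^2) (at z)"
      if "0 < z" "z \<le> x" for z
      using cos[OF that]
      by (auto intro!: derivative_eq_intros simp: tan_sec[symmetric] power_inverse[symmetric])
    show "((\<lambda>x::real. tan x - x - x^3/3) \<longlongrightarrow> 0) (at_right 0)" by real_asymp
    show "0 < (tan z)^2 - z^2" if z: "0 < z" "z < x" for z
    proof -
      have "z < tan z"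
        using mult_cos_less_sin[of z] z cos[of z] assms by (simp add: tan_def field_simps)
      then show ?thesis using z by (simp add: power_strict_mono)
    qed
  qed (use assms in auto)
  then show ?thesis by simp
qed

section \<open>Wilker-type inequalities and their consequences\<close>

text \<open>In the sum of the two cubic bounds the quadratic terms cancel, leaving the surplus
  \<open>y^4/36\<close>. The range up to \<open>pi/4\<close> is what a half angle requires.\<close>

lemma Wilker_first:
  fixes y :: real
  assumes "0 < y" "y \<le> pi/4"
  shows "2 < (sin y / y)^2 + tan y / y"
proof -
  \<comment> \<open>This keeps \<open>1 - y^2/6\<close> nonnegative, so that the lower bound for
    \<open>sin y / y\<close> may be squared.\<close>
  have "y < 1" using assms pi_less_4 by simp
  then have "y^2 < 1" using assms by (simp add: power_less_one_iff)
  have "1 - y^2/6 < sin y / y"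
    using sin_greater_cubic[of y] assms by (simp add: field_simps power3_eq_cube power2_eq_square)
  then have "(1 - y^2/6)^2 < (sin y / y)^2"
    using \<open>y^2 < 1\<close> by (intro power_strict_mono) auto
  moreover have "(1 - y^2/6)^2 = 1 - y^2/3 + y^4/36"
    by (simp add: power2_diff power_divide)
  moreover have "1 + y^2/3 < tan y / y"
    using tan_greater_cubic[of y] assms by (simp add: field_simps power3_eq_cube power2_eq_square)
  moreover have "y^4 > 0" using assms by simp
  ultimately show ?thesis by linarith
qed

text \<open>This is \<open>Wilker_first\<close> at the half angle times \<open>(cos y)^2\<close>,
  because \<open>sin y * cos y / y = sin t / t\<close>.\<close>

lemma one_plus_cos_less_sinc:
  fixes t :: real
  assumes "0 < t" "t \<le> pi/2"
  shows "1 + cos t < (sin t / t)^2 + sin t / t"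
proof -
  define y where "y = t/2"
  have t: "t = 2 * y" by (simp add: y_def)
  have y: "0 < y" "y \<le> pi/4" using assms by (auto simp: y_def)
  have c: "cos y > 0" using y by (intro cos_gt_zero_pi) auto
  have "2 * (cos y)^2 < ((sin y / y)^2 + tan y / y) * (cos y)^2"
    using Wilker_first[OF y] c by (intro mult_strict_right_mono) auto
  also have "\<dots> = (sin t / t)^2 + sin t / t"
    using c y by (simp only: t sin_double) (simp add: tan_def field_simps power2_eq_square)
  also have "2 * (cos y)^2 = 1 + cos t" by (simp add: t cos_double_cos)
  finally show ?thesis .
qed

text \<open>The derivative becomes a product in the half angle, with sign given by
  \<open>mult_cos_less_sin\<close>. The range reaches \<open>pi\<close> to allow use at a doubled
  angle.\<close>

lemma Cusa_Huygens:
  fixes s :: real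
  assumes "0 < s" "s \<le> pi"
  shows "3 * sin s < s * (2 + cos s)"
proof -
  have "0 < s * (2 + cos s) - 3 * sin s"
  proof (rule DERIV_pos_imp_greater_right_limit[where f = "\<lambda>s. s * (2 + cos s) - 3 * sin s"
        and f' = "\<lambda>s. 2 - 2 * cos s - s * sin s" and b = pi])
    show "((\<lambda>s. s * (2 + cos s) - 3 * sin s) has_real_derivative 2 - 2 * cos s - s * sin s) (at s)"
      for s :: real by (auto intro!: derivative_eq_intros simp: algebra_simps)
    show "((\<lambda>s::real. s * (2 + cos s) - 3 * sin s) \<longlongrightarrow> 0) (at_right 0)" by real_asymp
    show "0 < 2 - 2 * cos s - s * sin s" if s: "0 < s" "s < pi" for s
    proof -
      define y where "y = s/2"
      have "2 - 2 * cos s - s * sin s = 4 * sin y * (sin y - y * cos y)"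
        using cos_double_sin[of y] sin_double[of y]
        by (simp add: y_def algebra_simps power2_eq_square)
      also have "\<dots> > 0"
        using mult_cos_less_sin[of y] s by (auto simp: y_def intro!: mult_pos_pos sin_gt_zero)
      finally show ?thesis .
    qed
  qed (use assms in auto)
  then show ?thesis by simp
qed

text \<open>In terms of \<open>2*t\<close> the difference of the two sides has as derivative half
  the gap in \<open>Cusa_Huygens\<close> at \<open>2*t\<close>.\<close>

lemma Wilker_second:
  fixes t :: real
  assumes "0 < t" "t \<le> pi/2"
  shows "2 * (sin t)^2 < t^2 + t * sin t * cos t"
proof -
  have "0 < t^2 + t * (sin (2*t) / 2) - (1 - cos (2*t))"
  proof (rule DERIV_pos_imp_greater_right_limit[
        where f = "\<lambda>t. t^2 + t * (sin (2*t) / 2) - (1 - cos (2*t))"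
        and f' = "\<lambda>t. (2*t * (2 + cos (2*t)) - 3 * sin (2*t)) / 2" and b = "pi/2"])
    show "((\<lambda>t. t^2 + t * (sin (2*t) / 2) - (1 - cos (2*t))) has_real_derivative
        (2*t * (2 + cos (2*t)) - 3 * sin (2*t)) / 2) (at t)" for t :: real
      by (auto intro!: derivative_eq_intros simp: field_simps)
    show "((\<lambda>t::real. t^2 + t * (sin (2*t) / 2) - (1 - cos (2*t))) \<longlongrightarrow> 0) (at_right 0)"
      by real_asymp
    show "0 < (2*t * (2 + cos (2*t)) - 3 * sin (2*t)) / 2" if "0 < t" "t < pi/2" for t
      using Cusa_Huygens[of "2*t"] that by simp
  qed (use assms in auto)
  then show ?thesis by (simp add: sin_double cos_double_sin)
qed

text \<open>After taking logarithms, the numerator of the derivative is the gap in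
  \<open>Wilker_second\<close>.\<close>

lemma exp_cot_less_sinc_square:
  fixes t :: real
  assumes "0 < t" "t < pi/2"
  shows "exp (t * cos t / sin t - 1) < (sin t / t)^2"
proof -
  have sin: "sin z > 0" if "0 < z" "z \<le> t" for z
    using that assms by (intro sin_gt_zero) auto
  have "0 < 2 * ln (sin t / t) + 1 - t * cos t / sin t"
  proof (rule DERIV_pos_imp_greater_right_limit[
        where f = "\<lambda>t. 2 * ln (sin t / t) + 1 - t * cos t / sin t"
        and f' = "\<lambda>t. (t^2 + t * sin t * cos t - 2 * (sin t)^2) / (t * (sin t)^2)" and b = t])
    show "((\<lambda>t. 2 * ln (sin t / t) + 1 - t * cos t / sin t) has_real_derivative
        (z^2 + z * sin z * cos z - 2 * (sin z)^2) / (z * (sin z)^2)) (at z)"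
      if z: "0 < z" "z \<le> t" for z
    proof -
      \<comment> \<open>The left side is what the derivative of \<open>- t * cos t / sin t\<close>
        contributes besides \<open>- cos z / sin z\<close>.\<close>
      have "z + z * (cos z)^2 / (sin z)^2 = z / (sin z)^2"
        using sin[OF z] by (simp add: field_simps) (use sin_cos_squared_add[of z] in algebra)
      then show ?thesis using z sin[OF z]
        by (auto intro!: derivative_eq_intros) (simp add: field_simps power2_eq_square)
    qed
    show "((\<lambda>t::real. 2 * ln (sin t / t) + 1 - t * cos t / sin t) \<longlongrightarrow> 0) (at_right 0)"
      by real_asymp
    show "0 < (z^2 + z * sin z * cos z - 2 * (sin z)^2) / (z * (sin z)^2)"
      if "0 < z" "z < t" for z
      using Wilker_second[of z] sin[of z] that assms by auto
  qed (use assms in auto)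
  then have "exp (t * cos t / sin t - 1) < exp (2 * ln (sin t / t))" by simp
  also have "\<dots> = (sin t / t)^2"
    using sin[of t] assms by (simp add: exp_double)
  finally show ?thesis .
qed

section \<open>Monotonicity of the two quotients of means\<close>

text \<open>For \<open>A = 1\<close> the function is \<open>-(A + G - P) / (e X)\<close>; the sign
  makes it increasing. Of the last two factors, \<open>1 - p\<close> is positive by
  \<open>sin t < t\<close> and the other by \<open>one_plus_cos_less_sinc\<close>.\<close>

lemma cot_exp_quotient_deriv:
  fixes t :: real
  assumes "0 < t" "t < pi"
  defines "p \<equiv> sin t / t"
  shows "((\<lambda>t. - ((1 + cos t - sin t / t) * exp (- (t * cos t / sin t)))) has_real_derivative
    exp (- (t * cos t / sin t)) * (t / (sin t)^2) * ((1 - p) * (p^2 + p - (1 + cos t)))) (at t)"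
proof -
  have s: "sin t > 0" using assms by (intro sin_gt_zero) auto
  have "((\<lambda>t. - ((1 + cos t - sin t / t) * exp (- (t * cos t / sin t)))) has_real_derivative
      - ((- sin t - (cos t * t - sin t) / t^2) * exp (- (t * cos t / sin t))
        + (1 + cos t - sin t / t) * (exp (- (t * cos t / sin t))
          * (- (((cos t - t * sin t) * sin t - t * cos t * cos t) / (sin t)^2))))) (at t)"
    using s assms by (auto intro!: derivative_eq_intros simp: power2_eq_square)
  also have "- ((- sin t - (cos t * t - sin t) / t^2) * exp (- (t * cos t / sin t))
        + (1 + cos t - sin t / t) * (exp (- (t * cos t / sin t))
          * (- (((cos t - t * sin t) * sin t - t * cos t * cos t) / (sin t)^2)))) =
      exp (- (t * cos t / sin t)) * - ((- sin t - (cos t * t - sin t) / t^2)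
        - (1 + cos t - sin t / t)
          * (((cos t - t * sin t) * sin t - t * cos t * cos t) / (sin t)^2))"
    by (simp add: algebra_simps)
  also have "- ((- sin t - (cos t * t - sin t) / t^2)
        - (1 + cos t - sin t / t)
          * (((cos t - t * sin t) * sin t - t * cos t * cos t) / (sin t)^2)) =
      t / (sin t)^2 * ((1 - p) * (p^2 + p - (1 + cos t)))"
    unfolding p_def using s assms(1,2)
    by (simp add: divide_simps) (use sin_cos_squared_add[of t] in algebra)
  finally show ?thesis by (simp only: mult.assoc)
qed

lemma cot_exp_quotient_bounds:
  fixes t :: real
  assumes t: "0 < t" "t < pi/2"
  defines "F \<equiv> (1 + cos t - sin t / t) * exp (- (t * cos t / sin t))"
  shows "1 - 2/pi < F" and "F < exp (-1)"
proof -
  let ?f = "\<lambda>t::real. - ((1 + cos t - sin t / t) * exp (- (t * cos t / sin t)))"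
  define f' where "f' = (\<lambda>t::real. exp (- (t * cos t / sin t)) * (t / (sin t)^2)
    * ((1 - sin t / t) * ((sin t / t)^2 + sin t / t - (1 + cos t))))"
  have deriv: "(?f has_real_derivative f' z) (at z)" if "0 < z" "z \<le> pi/2" for z
    unfolding f'_def using cot_exp_quotient_deriv[of z] that by simp
  have pos: "f' z > 0" if z: "0 < z" "z < pi/2" for z
  proof -
    have "sin z > 0" using z by (intro sin_gt_zero) auto
    moreover have "sin z / z < 1" using sin_less_arg[of z] z by simp
    ultimately show ?thesis
      unfolding f'_def using one_plus_cos_less_sinc[of z] z
      by (intro mult_pos_pos divide_pos_pos) auto
  qed
  have "(?f \<longlongrightarrow> - exp (-1)) (at_right 0)"
    by real_asymp
  then have "- exp (-1) < ?f t"
    using t by (intro DERIV_pos_imp_greater_right_limit[where f = ?f, OF deriv pos]) auto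
  then show "F < exp (-1)" by (simp add: F_def)
  \<comment> \<open>The quotient is continuous at \<open>pi/2\<close>, where the cosine vanishes, so
    the bound \<open>1 - 2/pi\<close> is a value and no limit is taken.\<close>
  have "?f t < ?f (pi/2)"
  proof (rule DERIV_pos_imp_increasing_open[OF t(2)])
    show "\<exists>y. (?f has_real_derivative y) (at z) \<and> 0 < y" if "t < z" "z < pi/2" for z
      using deriv[of z] pos[of z] that t by force
    show "continuous_on {t..pi/2} ?f"
      by (rule DERIV_continuous_on, rule has_field_derivative_at_within[OF deriv]) (use t in auto)
  qed
  then show "1 - 2/pi < F" by (simp add: F_def)
qed

lemma sinc_plus_exp_cot_less:
  fixes t :: real
  assumes t: "0 < t" "t < pi/2"
  shows "sin t / t + exp (t * cos t / sin t - 1) < (exp (-1) + 2/pi) * (1 + cos t)"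
proof -
  let ?f = "\<lambda>t::real. (sin t / t + exp (t * cos t / sin t - 1)) / (1 + cos t)"
  define f' where "f' = (\<lambda>t::real. (t - sin t) / (1 + cos t)
    * (1 / t^2 - exp (t * cos t / sin t - 1) / (sin t)^2))"
  have deriv: "(?f has_real_derivative f' z) (at z)" if z: "0 < z" "z \<le> pi/2" for z
  proof -
    have s: "sin z > 0" using z by (intro sin_gt_zero) auto
    have c: "1 + cos z > 0" using cos_ge_zero[of z] z by simp
    define E where "E = exp (z * cos z / sin z - 1)"
    have "(?f has_real_derivative
        (((cos z * z - sin z) / z^2 + E * (((cos z - z * sin z) * sin z - z * cos z * cos z) / (sin z)^2))
          * (1 + cos z) + (sin z / z + E) * sin z) / (1 + cos z)^2) (at z)"
      unfolding E_def using s c z by (auto intro!: derivative_eq_intros simp: power2_eq_square)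
    \<comment> \<open>By \<open>(sin z)^2 = (1 - cos z) * (1 + cos z)\<close>, the terms without
      \<open>E\<close> sum to \<open>(z - sin z) * (1 + cos z) / z^2\<close> in the numerator, and
      those with \<open>E\<close> to
      \<open>- E * (z - sin z) * (1 + cos z) / (sin z)^2\<close>.\<close>
    also have "(((cos z * z - sin z) / z^2 + E * (((cos z - z * sin z) * sin z - z * cos z * cos z) / (sin z)^2))
          * (1 + cos z) + (sin z / z + E) * sin z) / (1 + cos z)^2 =
        (z - sin z) / (1 + cos z) * (1 / z^2 - E / (sin z)^2)"
      using s c z by (simp add: divide_simps) (use sin_cos_squared_add[of z] in algebra)
    finally show ?thesis by (simp add: f'_def E_def)
  qed
  have pos: "f' z > 0" if z: "0 < z" "z < pi/2" for z
  proof -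
    have s: "sin z > 0" using z by (intro sin_gt_zero) auto
    have c: "1 + cos z > 0" using cos_ge_zero[of z] z by simp
    have "exp (z * cos z / sin z - 1) / (sin z)^2 < 1 / z^2"
      using exp_cot_less_sinc_square[OF z] s z by (simp add: field_simps)
    then show ?thesis
      unfolding f'_def using sin_less_arg[of z] z c by (intro mult_pos_pos divide_pos_pos) auto
  qed
  have "?f t < ?f (pi/2)"
  proof (rule DERIV_pos_imp_increasing_open[OF t(2)])
    show "\<exists>y. (?f has_real_derivative y) (at z) \<and> 0 < y" if "t < z" "z < pi/2" for z
      using deriv[of z] pos[of z] that t by force
    show "continuous_on {t..pi/2} ?f"
      by (rule DERIV_continuous_on, rule has_field_derivative_at_within[OF deriv]) (use t in auto)
  qed
  also have "?f (pi/2) = exp (-1) + 2/pi" by simp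
  finally show ?thesis
    using cos_ge_zero[of t] t by (subst (asm) pos_divide_less_eq) auto
qed

section \<open>Passage from the means to the angle \<open>t\<close>, and symmetry\<close>

lemma means_trig:
  fixes a b :: real
  assumes "0 < b" "b < a"
  defines "A \<equiv> arith_mean a b" and "t \<equiv> arcsin ((a - b) / (a + b))"
  shows "0 < t" "t < pi/2" "geo_mean a b = A * cos t" "seiffert_mean a b = A * (sin t / t)"
    "X_mean a b = A * exp (t * cos t / sin t - 1)"
proof -
  define v where "v = (a - b) / (a + b)"
  have v: "0 < v" "v < 1" using assms by (auto simp: v_def)
  have A: "A > 0" using assms by (simp add: A_def arith_mean_def)
  have sin: "sin t = v" using v by (simp add: t_def v_def[symmetric])
  show t: "0 < t" "t < pi/2"
    using v arcsin_less_arcsin[of 0 v] arcsin_lt_bounded[of v] by (auto simp: t_def v_def)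
  have "cos t > 0" using t by (intro cos_gt_zero) auto
  have "(A * cos t)^2 = A^2 * (1 - v^2)" by (simp add: power_mult_distrib cos_squared_eq sin)
  also have "\<dots> = A^2 - ((a - b) / 2)^2"
    using assms(1,2) by (simp add: A_def arith_mean_def v_def power_divide right_diff_distrib)
  also have "\<dots> = a * b" by (simp add: A_def arith_mean_def field_simps power2_eq_square)
  finally have "(A * cos t)^2 = a * b" .
  then show G: "geo_mean a b = A * cos t"
    using A \<open>cos t > 0\<close> unfolding geo_mean_def by (intro real_sqrt_unique) auto
  have "a - b = 2 * A * v" using assms by (simp add: A_def arith_mean_def v_def)
  then show P: "seiffert_mean a b = A * (sin t / t)"
    unfolding seiffert_mean_def t_def[symmetric] sin by simp
  have "geo_mean a b / seiffert_mean a b = t * cos t / sin t"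
    unfolding G P using A by simp
  then show "X_mean a b = A * exp (t * cos t / sin t - 1)"
    by (simp add: X_mean_def A_def)
qed


lemma arith_mean_commute: "arith_mean a b = arith_mean b a"
  by (simp add: arith_mean_def add.commute)

lemma geo_mean_commute: "geo_mean a b = geo_mean b a"
  by (simp add: geo_mean_def mult.commute)

text \<open>Numerator and arcsine both change sign; positivity puts the argument in the range where
  \<open>arcsin\<close> is odd.\<close>

lemma seiffert_mean_commute:
  assumes "a > 0" "b > 0"
  shows "seiffert_mean a b = seiffert_mean b a"
proof -
  have "(a - b) / (a + b) = - ((b - a) / (b + a))"
    using assms by (simp add: divide_simps)
  moreover have "arcsin (- ((b - a) / (b + a))) = - arcsin ((b - a) / (b + a))"
    using assms by (intro arcsin_minus) (auto simp: field_simps)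
  ultimately have "arcsin ((a - b) / (a + b)) = - arcsin ((b - a) / (b + a))"
    by simp
  then have "seiffert_mean a b = - (b - a) / - (2 * arcsin ((b - a) / (b + a)))"
    by (simp add: seiffert_mean_def)
  then show ?thesis by (simp only: seiffert_mean_def minus_divide_divide)
qed

lemma X_mean_commute:
  assumes "a > 0" "b > 0"
  shows "X_mean a b = X_mean b a"
  using seiffert_mean_commute[OF assms] arith_mean_commute[of a b] geo_mean_commute[of a b]
  by (simp add: X_mean_def)

text \<open>All four means are \<open>A\<close> times a function of \<open>t\<close>, so each bound
  is a one-variable inequality scaled by \<open>A > 0\<close>.\<close>

lemma mean_bounds_ordered:
  fixes a b :: real
  assumes "0 < b" "b < a"
  shows "exp 1 * (pi - 2) / pi * X_mean a b + seiffert_mean a b < arith_mean a b + geo_mean a b"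
    and "arith_mean a b + geo_mean a b < seiffert_mean a b + X_mean a b"
    and "seiffert_mean a b + X_mean a b < (exp (-1) + 2/pi) * (arith_mean a b + geo_mean a b)"
proof -
  define A t where "A = arith_mean a b" and "t = arcsin ((a - b) / (a + b))"
  define p w where "p = sin t / t" and "w = exp (t * cos t / sin t - 1)"
  note m = means_trig[OF assms, folded A_def t_def]
  have "A > 0" using assms by (simp add: A_def arith_mean_def)
  have w: "exp (- (t * cos t / sin t)) = exp (-1) / w"
    by (simp add: w_def exp_diff exp_minus field_simps)
  have "w > 0" by (simp add: w_def)
  have "1 - 2/pi < (1 + cos t - p) * (exp (-1) / w)"
    using cot_exp_quotient_bounds(1)[OF m(1,2)] by (simp only: w p_def)
  then have lower: "exp 1 * (pi - 2) / pi * w + p < 1 + cos t"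
    using \<open>w > 0\<close> by (simp add: field_simps exp_minus)
  have "(1 + cos t - p) * (exp (-1) / w) < exp (-1)"
    using cot_exp_quotient_bounds(2)[OF m(1,2)] by (simp only: w p_def)
  \<comment> \<open>This exposes the common positive factor \<open>exp (-1) / w\<close>, which is
    then cancelled.\<close>
  also have "exp (-1) = w * (exp (-1) / w)" using \<open>w > 0\<close> by simp
  finally have "1 + cos t - p < w"
    using \<open>w > 0\<close> by (subst (asm) mult_less_cancel_right_pos) auto
  then have middle: "1 + cos t < p + w" by simp
  have upper: "p + w < (exp (-1) + 2/pi) * (1 + cos t)"
    using sinc_plus_exp_cot_less[OF m(1,2)] by (simp add: p_def w_def)
  have means: "arith_mean a b = A" "geo_mean a b = A * cos t" "seiffert_mean a b = A * p"
      "X_mean a b = A * w"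
    using m by (simp_all add: A_def p_def w_def)
  show "exp 1 * (pi - 2) / pi * X_mean a b + seiffert_mean a b < arith_mean a b + geo_mean a b"
    using mult_strict_left_mono[OF lower \<open>A > 0\<close>] unfolding means by (simp add: algebra_simps)
  show "arith_mean a b + geo_mean a b < seiffert_mean a b + X_mean a b"
    using mult_strict_left_mono[OF middle \<open>A > 0\<close>] unfolding means by (simp add: algebra_simps)
  show "seiffert_mean a b + X_mean a b < (exp (-1) + 2/pi) * (arith_mean a b + geo_mean a b)"
    using mult_strict_left_mono[OF upper \<open>A > 0\<close>] unfolding means
    by (simp add: algebra_simps add_divide_distrib)
qed

theorem proposition7:
  fixes a b :: real
  assumes "a > 0" and "b > 0" and "a \<noteq> b"
  shows "(exp 1 * (pi - 2) / pi * X_mean a b + seiffert_mean a b) / 2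
           < (arith_mean a b + geo_mean a b) / 2
       \<and> (arith_mean a b + geo_mean a b) / 2
           < (seiffert_mean a b + X_mean a b) / 2
       \<and> (seiffert_mean a b + X_mean a b) / 2
           < (exp (-1) + 2 / pi) * ((arith_mean a b + geo_mean a b) / 2)"
proof (cases "b < a")
  case True
  then show ?thesis using mean_bounds_ordered[OF \<open>b > 0\<close> True]
    by (simp only: times_divide_eq_right divide_strict_right_mono zero_less_numeral simp_thms)
next
  case False
  then have "a < b" using assms by simp
  note bounds = mean_bounds_ordered[OF \<open>a > 0\<close> this]
  show ?thesis
    using bounds
    unfolding arith_mean_commute[of a b] geo_mean_commute[of a b]
      seiffert_mean_commute[OF assms(1,2)] X_mean_commute[OF assms(1,2)]
    by (simp only: times_divide_eq_right divide_strict_right_mono zero_less_numeral simp_thms)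
qed

end
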